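(* For every graph $G$ and every ideal $\mathcal I$ the following are equivalent: (i) $G$ has an $\mathcal I$-rank; (ii) $G$ is $\mathcal I$-traceable. Moreover, if (i) and (ii) hold, then the $\mathcal I$-rank of $G$ equals $$\min\{\aleph_0\text{-rank of } T \mid (T,\mathcal V) \text{ is a rayless tree-decomposition of } G \text{ with all parts in } \mathcal I\}.$$
   Context: An ideal is a class $\mathcal I$ (of sets) that contains $\emptyset$, is closed under finite unions, and is closed under taking subsets of its elements (it may be a proper class). For an ideal $\mathcal I$, the $\mathcal I$-rank is defined by transfinite recursion: a graph has $\mathcal I$-rank $0$ if its vertex set lies in $\mathcal I$; for an ordinal $\alpha>0$, a graph $G$ has $\mathcal I$-rank $\alpha$ if it does not have an $\mathcal I$-rank less than $\alpha$ and there is a vertex set $X\in\mathcal I$ such that every component of $G-X$ has some $\mathcal I$-rank less than $\alpha$. The $\aleph_0$-rank (Schmidt's rank) is the $\mathcal I$-rank for $\mathcal I$ the class of all finite sets; exactly the rayless graphs have an $\aleph_0$-rank. A tree-decomposition $(T,\mathcal V)$, $\mathcal V=(V_t)_{t\in T}$, is rayless if $T$ contains no ray (one-way infinite path), and its parts are the sets $V_t$. A graph $G$ is $\mathcal I$-traceable if it has a rayless tree-decomposition with all parts in $\mathcal I$. *)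

theory Defs
  imports Main
begin

section \<open>Ordinals\<close>

text \<open>
  The order type of \<^term>\<open>cardSuc (card_of (UNIV :: 'a set))\<close> is the least ordinal whose
  cardinality exceeds that of \<open>'a\<close>.  Hence the elements of \<open>'a ordinal\<close> are, up to isomorphism,
  exactly the ordinals of cardinality at most that of \<open>'a\<close>.
\<close>

typedef 'a ordinal = "Field (cardSuc (card_of (UNIV :: 'a set)))"
proof -
  let ?r = "card_of (UNIV :: 'a set)"
  have "Field (cardSuc ?r) \<noteq> {}"
  proof
    assume "Field (cardSuc ?r) = {}"
    then have "ordIso2 (card_of ({} :: 'a set set)) (cardSuc ?r)"
      using card_of_Field_ordIso[OF cardSuc_Card_order[OF card_of_Card_order, of "UNIV :: 'a set"]]
      by simp
    moreover have "ordLeq3 (card_of ({} :: 'a set set)) ?r"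
      by (rule card_of_empty)
    ultimately have "ordLeq3 (cardSuc ?r) ?r"
      using ordIso_ordLeq_trans ordIso_symmetric by blast
    then show False
      using cardSuc_greater[OF card_of_Card_order] not_ordLess_ordLeq by blast
  qed
  then show ?thesis by blast
qed

instantiation ordinal :: (type) "{wellorder, zero}"
begin

definition less_eq_ordinal :: "'a ordinal \<Rightarrow> 'a ordinal \<Rightarrow> bool" where
  "\<alpha> \<le> \<beta> \<longleftrightarrow> (Rep_ordinal \<alpha>, Rep_ordinal \<beta>) \<in> cardSuc (card_of (UNIV :: 'a set))"

definition less_ordinal :: "'a ordinal \<Rightarrow> 'a ordinal \<Rightarrow> bool" where
  "(\<alpha> :: 'a ordinal) < \<beta> \<longleftrightarrow> \<alpha> \<le> \<beta> \<and> \<alpha> \<noteq> \<beta>"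

definition zero_ordinal :: "'a ordinal" where
  "0 = (THE \<alpha> :: 'a ordinal. \<forall>\<beta>. \<alpha> \<le> \<beta>)"

instance
proof
  let ?r = "cardSuc (card_of (UNIV :: 'a set))"
  have wo: "Well_order ?r"
    using cardSuc_Card_order[OF card_of_Card_order] card_order_on_well_order_on by blast
  then have lin: "Linear_order ?r" and wf: "wf (?r - Id)"
    unfolding well_order_on_def by auto
  have rfl: "refl_on (Field ?r) ?r" and trn: "trans ?r" and asm: "antisym ?r"
    and tot: "total_on (Field ?r) ?r"
    using lin unfolding linear_order_on_def partial_order_on_def preorder_on_def by auto
  fix x y z :: "'a ordinal"
  show refl: "x \<le> x"
    using rfl Rep_ordinal unfolding less_eq_ordinal_def refl_on_def by blast
  show "x \<le> z" if "x \<le> y" "y \<le> z"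
    using that trn unfolding less_eq_ordinal_def by (meson transD)
  show anti: "x = y" if "x \<le> y" "y \<le> x"
    using that asm unfolding less_eq_ordinal_def by (meson Rep_ordinal_inject antisymD)
  show "x \<le> y \<or> y \<le> x"
    using tot refl Rep_ordinal[of x] Rep_ordinal[of y]
    unfolding less_eq_ordinal_def total_on_def by (metis Rep_ordinal_inject)
  show "(x < y) = (x \<le> y \<and> \<not> y \<le> x)"
    using anti refl unfolding less_ordinal_def by blast
  have lt: "{(a :: 'a ordinal, b). a < b} = inv_image (?r - Id) Rep_ordinal"
    unfolding less_ordinal_def less_eq_ordinal_def inv_image_def
    by (auto simp: Rep_ordinal_inject)
  show "P x" if "\<And>x. (\<And>y. y < x \<Longrightarrow> P y) \<Longrightarrow> P x" for P
  proof -
    have "wf {(a :: 'a ordinal, b). a < b}" unfolding lt using wf by (rule wf_inv_image)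
    then show ?thesis by (rule wf_induct) (use that in auto)
  qed
qed

end


section \<open>Graphs\<close>

record 'v ugraph =
  verts :: "'v set"
  edges :: "'v set set"

definition simple_graph :: "'v ugraph \<Rightarrow> bool" where
  "simple_graph G \<longleftrightarrow> (\<forall>e\<in>edges G. \<exists>u\<in>verts G. \<exists>v\<in>verts G. u \<noteq> v \<and> e = {u, v})"

definition is_subgraph :: "'v ugraph \<Rightarrow> 'v ugraph \<Rightarrow> bool" where
  "is_subgraph H G \<longleftrightarrow> simple_graph H \<and> verts H \<subseteq> verts G \<and> edges H \<subseteq> edges G"

definition delete_verts :: "'v ugraph \<Rightarrow> 'v set \<Rightarrow> 'v ugraph" where
  "delete_verts G X = \<lparr>verts = verts G - X, edges = {e \<in> edges G. e \<inter> X = {}}\<rparr>"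

definition is_path :: "'v ugraph \<Rightarrow> 'v list \<Rightarrow> bool" where
  "is_path G p \<longleftrightarrow> p \<noteq> [] \<and> distinct p \<and> set p \<subseteq> verts G
     \<and> successively (\<lambda>u v. {u, v} \<in> edges G) p"

text \<open>As usual, connected graphs (hence components and trees) are non-empty.\<close>

definition connected_graph :: "'v ugraph \<Rightarrow> bool" where
  "connected_graph G \<longleftrightarrow> verts G \<noteq> {}
     \<and> (\<forall>u\<in>verts G. \<forall>v\<in>verts G. \<exists>p. is_path G p \<and> hd p = u \<and> last p = v)"

definition is_component :: "'v ugraph \<Rightarrow> 'v ugraph \<Rightarrow> bool" where
  "is_component C G \<longleftrightarrow> is_subgraph C G \<and> connected_graph C
     \<and> (\<forall>D. is_subgraph D G \<and> connected_graph D \<and> is_subgraph C D \<longrightarrow> D = C)"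

definition is_cycle :: "'v ugraph \<Rightarrow> 'v list \<Rightarrow> bool" where
  "is_cycle G c \<longleftrightarrow> is_path G c \<and> length c \<ge> 3 \<and> {last c, hd c} \<in> edges G"

definition is_tree :: "'v ugraph \<Rightarrow> bool" where
  "is_tree T \<longleftrightarrow> simple_graph T \<and> connected_graph T \<and> (\<nexists>c. is_cycle T c)"

definition is_ray :: "'v ugraph \<Rightarrow> (nat \<Rightarrow> 'v) \<Rightarrow> bool" where
  "is_ray G f \<longleftrightarrow> inj f \<and> (\<forall>n. f n \<in> verts G \<and> {f n, f (Suc n)} \<in> edges G)"

definition rayless :: "'v ugraph \<Rightarrow> bool" where
  "rayless G \<longleftrightarrow> (\<nexists>f. is_ray G f)"

definition tree_decomposition :: "'v ugraph \<Rightarrow> 't ugraph \<Rightarrow> ('t \<Rightarrow> 'v set) \<Rightarrow> bool" where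
  "tree_decomposition G T V \<longleftrightarrow> is_tree T
     \<and> (\<Union>t\<in>verts T. V t) = verts G
     \<and> (\<forall>e\<in>edges G. \<exists>t\<in>verts T. e \<subseteq> V t)
     \<and> (\<forall>p. is_path T p \<longrightarrow> (\<forall>t\<in>set p. V (hd p) \<inter> V (last p) \<subseteq> V t))"


section \<open>Ideals, rank and traceability\<close>

text \<open>
  Only the members of an ideal that are sets of vertices of the graph under consideration play a
  role, so an ideal (possibly a proper class) is represented by its trace on the vertex type.
\<close>

definition ideal :: "'v set set \<Rightarrow> bool" where
  "ideal I \<longleftrightarrow> {} \<in> I \<and> (\<forall>A\<in>I. \<forall>B\<in>I. A \<union> B \<in> I) \<and> (\<forall>A\<in>I. \<forall>B. B \<subseteq> A \<longrightarrow> B \<in> I)"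

declare conj_cong [fundef_cong]

function has_rank :: "'v set set \<Rightarrow> 'v ugraph \<Rightarrow> 'o ordinal \<Rightarrow> bool" where
  "has_rank I G \<alpha> \<longleftrightarrow>
     (if \<alpha> = 0 then verts G \<in> I
      else (\<forall>\<beta>. \<beta> < \<alpha> \<longrightarrow> \<not> has_rank I G \<beta>)
        \<and> (\<exists>X. X \<subseteq> verts G \<and> X \<in> I
             \<and> (\<forall>C. is_component C (delete_verts G X) \<longrightarrow> (\<exists>\<beta>. \<beta> < \<alpha> \<and> has_rank I C \<beta>))))"
  by pat_completeness auto
termination
  by (relation "inv_image {(\<alpha>, \<beta>). \<alpha> < \<beta>} (\<lambda>(I, G, \<alpha>). \<alpha>)") (auto intro: wf_inv_image wf)

declare has_rank.simps [simp del]
declare conj_cong [fundef_cong del]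

text \<open>A graph has at most one rank; \<open>rank_of\<close> is meaningful only for graphs that have a rank.\<close>

definition rank_of :: "'v set set \<Rightarrow> 'v ugraph \<Rightarrow> 'o ordinal" where
  "rank_of I G = (THE \<alpha>. has_rank I G \<alpha>)"

definition aleph0_rank :: "'v ugraph \<Rightarrow> 'o ordinal" where
  "aleph0_rank G = rank_of {A. finite A} G"

definition rayless_decomposition_into ::
    "'v set set \<Rightarrow> 'v ugraph \<Rightarrow> 't ugraph \<Rightarrow> ('t \<Rightarrow> 'v set) \<Rightarrow> bool" where
  "rayless_decomposition_into I G T V \<longleftrightarrow>
     tree_decomposition G T V \<and> rayless T \<and> (\<forall>t\<in>verts T. V t \<in> I)"

text \<open>
  The type argument fixes the type from which the nodes of decomposition trees are taken.  Letting
  it (and likewise the index type of \<open>ordinal\<close>) range over all sufficiently large types plays the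
  role of quantifying over the proper class of all trees (and of all ordinals).
\<close>

definition traceable :: "'t itself \<Rightarrow> 'v set set \<Rightarrow> 'v ugraph \<Rightarrow> bool" where
  "traceable (_ :: 't itself) I G \<longleftrightarrow>
     (\<exists>(T :: 't ugraph) V. rayless_decomposition_into I G T V)"

end

theory Submission
  imports Defs "HOL-Library.Sublist"
begin

text \<open>
  Both inequalities are by transfinite induction on the rank.  If deleting a finite set of nodes
  from \<^term>\<open>T\<close> leaves only components of smaller rank, then deleting the union of the
  corresponding parts from \<^term>\<open>G\<close> leaves components that each live in one of these components
  of \<^term>\<open>T\<close>.  Conversely, if \<^term>\<open>X\<close> reduces the rank of \<^term>\<open>G\<close>, then decomposition trees of
  the components of \<^term>\<open>G - X\<close> are joined by a new root with part \<^term>\<open>X\<close>, and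
  \<^term>\<open>X\<close> is added to every other part.  Nodes of this tree are lists of vertices, namely
  sequences of representatives of nested components.  Finally, a rayless graph has an
  \<open>\<aleph>\<^sub>0\<close>-rank: from a graph without rank one finds a ray by repeatedly deleting a vertex
  and moving to a component without rank.
\<close>

section \<open>Connectivity and components\<close>

text \<open>Walks are used instead of the paths of \<open>connected_graph\<close>, so that
  transitivity needs no shortcutting. The relation is reflexive at every element of the type, also
  outside \<open>verts G\<close>.\<close>

definition reach :: "'v ugraph \<Rightarrow> 'v \<Rightarrow> 'v \<Rightarrow> bool" where
  "reach G = (\<lambda>u v. {u, v} \<in> edges G)\<^sup>*\<^sup>*"

definition induced :: "'v ugraph \<Rightarrow> 'v set \<Rightarrow> 'v ugraph" where
  "induced G U = \<lparr>verts = verts G \<inter> U, edges = {e \<in> edges G. e \<subseteq> U}\<rparr>"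

definition component_of :: "'v ugraph \<Rightarrow> 'v \<Rightarrow> 'v ugraph" where
  "component_of G v = induced G {u. reach G v u}"

lemma verts_induced [simp]: "verts (induced G U) = verts G \<inter> U"
  and edges_induced [simp]: "edges (induced G U) = {e \<in> edges G. e \<subseteq> U}"
  by (simp_all add: induced_def)

lemma verts_delete_verts [simp]: "verts (delete_verts G X) = verts G - X"
  and edges_delete_verts [simp]: "edges (delete_verts G X) = {e \<in> edges G. e \<inter> X = {}}"
  by (simp_all add: delete_verts_def)

lemma verts_component_of [simp]: "verts (component_of G v) = {u \<in> verts G. reach G v u}"
  and edges_component_of [simp]:
    "edges (component_of G v) = {e \<in> edges G. \<forall>u\<in>e. reach G v u}"
  by (auto simp: component_of_def)

lemma simple_graph_edgeD: "simple_graph G \<Longrightarrow> {u, v} \<in> edges G \<Longrightarrow> u \<in> verts G \<and> v \<in> verts G \<and> u \<noteq> v"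
  unfolding simple_graph_def by (metis doubleton_eq_iff insert_absorb2)

lemma simple_graphE:
  assumes "simple_graph G" "e \<in> edges G"
  obtains u v where "e = {u, v}" "u \<in> verts G" "v \<in> verts G" "u \<noteq> v"
  using assms unfolding simple_graph_def by blast

lemma simple_delete_verts: "simple_graph G \<Longrightarrow> simple_graph (delete_verts G X)"
  unfolding simple_graph_def by fastforce

lemma simple_induced: "simple_graph G \<Longrightarrow> simple_graph (induced G U)"
  unfolding simple_graph_def by fastforce

lemma simple_component_of: "simple_graph G \<Longrightarrow> simple_graph (component_of G v)"
  unfolding component_of_def by (rule simple_induced)

lemma reach_refl [simp]: "reach G u u"
  by (simp add: reach_def)

lemma reach_trans: "reach G u v \<Longrightarrow> reach G v w \<Longrightarrow> reach G u w"
  unfolding reach_def by (rule rtranclp_trans)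

lemma reach_edge: "{u, v} \<in> edges G \<Longrightarrow> reach G u v"
  unfolding reach_def by auto

lemma reach_sym: "reach G u v \<Longrightarrow> reach G v u"
  unfolding reach_def
proof (induction rule: rtranclp_induct)
  case (step y z)
  then have "{z, y} \<in> edges G" by (simp add: insert_commute)
  then show ?case using step.IH by (rule converse_rtranclp_into_rtranclp)
qed simp

lemma reach_mono: "edges G \<subseteq> edges H \<Longrightarrow> reach G u v \<Longrightarrow> reach H u v"
  unfolding reach_def by (erule rtranclp_mono[THEN predicate2D, rotated]) auto

lemma reach_verts:
  assumes "simple_graph G" "reach G u v" "u \<in> verts G"
  shows "v \<in> verts G"
  using assms(2,3) unfolding reach_def
  by (induction rule: rtranclp_induct) (auto dest: simple_graph_edgeD[OF assms(1)])

text \<open>Every vertex on a walk from \<open>v\<close> is itself reachable from \<open>v\<close>,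
  so the walk never leaves the component.\<close>

lemma reach_component_of: "reach G v u \<Longrightarrow> reach (component_of G v) v u"
  unfolding reach_def[of G]
proof (induction rule: rtranclp_induct)
  case (step y z)
  then have "{y, z} \<in> edges (component_of G v)"
    unfolding reach_def[symmetric] by (auto intro: reach_trans reach_edge)
  with step.IH show ?case by (blast intro: reach_trans reach_edge)
qed simp

lemma reach_if_successively:
  assumes "p \<noteq> []" "successively (\<lambda>u v. {u, v} \<in> edges G) p" "\<And>t. t \<in> set p \<Longrightarrow> t \<in> U"
  shows "reach (induced G U) (hd p) (last p)"
  using assms
proof (induction p rule: induct_list012)
  case (3 x y zs)
  then have "reach (induced G U) x y" by (intro reach_edge) auto
  moreover have "reach (induced G U) y (last (y # zs))" using 3 by auto
  ultimately show ?case by (auto intro: reach_trans)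
qed auto

lemma reach_if_path: "is_path G p \<Longrightarrow> reach G (hd p) (last p)"
  using reach_if_successively[of p G UNIV] reach_mono[of "induced G UNIV" G]
  unfolding is_path_def by auto

lemma path_if_reach:
  assumes "simple_graph G" "reach G u v" "u \<in> verts G"
  shows "\<exists>p. is_path G p \<and> hd p = u \<and> last p = v"
  using assms(2) unfolding reach_def
proof (induction rule: rtranclp_induct)
  case base
  show ?case using assms(3) by (intro exI[of _ "[u]"]) (auto simp: is_path_def)
next
  case (step v w)
  then obtain p where p: "is_path G p" "hd p = u" "last p = v" by blast
  show ?case
  proof (cases "w \<in> set p")
    \<comment> \<open>The walk returns to a vertex of the path: cutting the path at that vertex
      keeps it free of repetitions.\<close>
    case True
    then obtain q r where q: "p = q @ w # r" by (meson split_list)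
    have "is_path G (q @ [w])"
      using p(1) unfolding q is_path_def by (auto simp: successively_append_iff)
    moreover have "hd (q @ [w]) = u" using p(2) unfolding q by (cases q) auto
    ultimately show ?thesis by (intro exI[of _ "q @ [w]"]) auto
  next
    case False
    have "is_path G (p @ [w])"
      using p False step.hyps(2) simple_graph_edgeD[OF assms(1) step.hyps(2)]
      unfolding is_path_def by (auto simp: successively_append_iff)
    moreover have "hd (p @ [w]) = u" using p unfolding is_path_def by simp
    ultimately show ?thesis by (intro exI[of _ "p @ [w]"]) auto
  qed
qed

lemma connected_graph_iff:
  assumes "simple_graph G"
  shows "connected_graph G \<longleftrightarrow> verts G \<noteq> {} \<and> (\<forall>u\<in>verts G. \<forall>v\<in>verts G. reach G u v)"
  using path_if_reach[OF assms] reach_if_path unfolding connected_graph_def by metis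

text \<open>Among the connected subgraphs containing \<open>v\<close>,
  \<open>component_of G v\<close> is not only maximal but greatest (\<open>below\<close>).
  Components can thus be indexed by vertices.\<close>

lemma is_component_iff:
  assumes G: "simple_graph G"
  shows "is_component C G \<longleftrightarrow> (\<exists>v\<in>verts G. C = component_of G v)"
proof -
  have sub: "is_subgraph (component_of G v) G" for v
    using simple_component_of[OF G] unfolding is_subgraph_def by auto
  have conn: "connected_graph (component_of G v)" if "v \<in> verts G" for v
  proof -
    have "reach (component_of G v) u w" if "reach G v u" "reach G v w" for u w
      using that by (meson reach_component_of reach_sym reach_trans)
    moreover have "v \<in> verts (component_of G v)" using that by simp
    ultimately show ?thesis
      unfolding connected_graph_iff[OF simple_component_of[OF G]] by auto
  qed
  have below: "is_subgraph D (component_of G v)"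
    if D: "is_subgraph D G" "connected_graph D" "v \<in> verts D" for D v
  proof -
    have sD: "simple_graph D" using D unfolding is_subgraph_def by blast
    have r: "reach G v u" if "u \<in> verts D" for u
      using D that connected_graph_iff[OF sD] reach_mono[of D G] unfolding is_subgraph_def by blast
    have "reach G v u" if "e \<in> edges D" "u \<in> e" for e u
      using that sD r by (metis simple_graph_def insert_iff singletonD)
    then show ?thesis
      using D r unfolding is_subgraph_def by auto
  qed
  have eq: "D = D'" if "is_subgraph D D'" "is_subgraph D' D" for D D' :: "'a ugraph"
    using that unfolding is_subgraph_def by (intro ugraph.equality) auto
  show ?thesis
  proof
    assume C: "is_component C G"
    then obtain v where v: "v \<in> verts C" unfolding is_component_def connected_graph_def by blast
    with C have vG: "v \<in> verts G" unfolding is_component_def is_subgraph_def by blast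
    have "is_subgraph C (component_of G v)" using below C v unfolding is_component_def by blast
    then have "component_of G v = C" using C sub conn[OF vG] unfolding is_component_def by blast
    with vG show "\<exists>v\<in>verts G. C = component_of G v" by blast
  next
    assume "\<exists>v\<in>verts G. C = component_of G v"
    then obtain v where v: "v \<in> verts G" and C: "C = component_of G v" by blast
    have "D = C" if D: "is_subgraph D G" "connected_graph D" "is_subgraph C D" for D
    proof -
      have "v \<in> verts D" using D(3) v unfolding C is_subgraph_def by auto
      then show ?thesis using below[OF D(1,2)] D(3) eq unfolding C by blast
    qed
    then show "is_component C G" using sub conn[OF v] unfolding is_component_def C by blast
  qed
qed


section \<open>Bounded rank\<close>

lemma zero_le_ordinal [simp]: "(0 :: 'o ordinal) \<le> \<alpha>"
proof -
  define m where "m = (LEAST \<alpha> :: 'o ordinal. True)"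
  have m: "\<forall>\<beta>. m \<le> \<beta>" unfolding m_def by (simp add: Least_le)
  have "(THE \<alpha> :: 'o ordinal. \<forall>\<beta>. \<alpha> \<le> \<beta>) = m"
    using m by (intro the_equality) (auto intro: order_antisym)
  then show ?thesis using m unfolding zero_ordinal_def by simp
qed

text \<open>An upper bound is monotone in \<alpha>, whereas \<open>has_rank\<close> holds for at
  most one ordinal; the transfinite inductions below run on the bound.\<close>

definition rank_le :: "'v set set \<Rightarrow> 'v ugraph \<Rightarrow> 'o ordinal \<Rightarrow> bool" where
  "rank_le I G \<alpha> \<longleftrightarrow> (\<exists>\<beta>\<le>\<alpha>. has_rank I G \<beta>)"

lemma has_rank_unique:
  assumes "has_rank I G \<alpha>" "has_rank I G \<beta>"
  shows "\<alpha> = (\<beta> :: 'o ordinal)"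
proof (rule ccontr)
  have less: False if "has_rank I G \<alpha>" "has_rank I G \<beta>" "\<alpha> < \<beta>" for \<alpha> \<beta> :: "'o ordinal"
  proof -
    \<comment> \<open>The clause of \<open>has_rank\<close> that excludes smaller ranks belongs to
      the nonzero branch only.\<close>
    have "\<beta> \<noteq> 0" using that(3) by (metis leD zero_le_ordinal)
    with that show False by (simp add: has_rank.simps[of I G \<beta>])
  qed
  assume "\<alpha> \<noteq> \<beta>"
  then show False using less assms by (metis neqE)
qed

lemma rank_of_eq: "has_rank I G \<alpha> \<Longrightarrow> rank_of I G = \<alpha>"
  unfolding rank_of_def by (blast intro: has_rank_unique the_equality)

lemma rank_le_iff_rank_of:
  "rank_le I G (\<alpha> :: 'o ordinal) \<longleftrightarrow> (\<exists>\<beta> :: 'o ordinal. has_rank I G \<beta>) \<and> rank_of I G \<le> \<alpha>"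
  unfolding rank_le_def using rank_of_eq by metis

text \<open>
  The upper bound version of rank needs no case distinction at 0: for a graph with vertex set in
  \<^term>\<open>I\<close>, delete everything.
\<close>

lemma rank_le_iff:
  fixes \<alpha> :: "'o ordinal"
  assumes G: "simple_graph G" and I: "ideal I"
  shows "rank_le I G \<alpha> \<longleftrightarrow> (\<exists>X. X \<subseteq> verts G \<and> X \<in> I \<and>
    (\<forall>v\<in>verts G - X. \<exists>\<beta><\<alpha>. rank_le I (component_of (delete_verts G X) v) \<beta>))"
proof -
  define Q where "Q \<alpha> \<longleftrightarrow> (\<exists>X. X \<subseteq> verts G \<and> X \<in> I \<and>
    (\<forall>v\<in>verts G - X. \<exists>\<beta><\<alpha>. rank_le I (component_of (delete_verts G X) v) \<beta>))" for \<alpha> :: "'o ordinal"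
  have comp: "is_component C (delete_verts G X) \<longleftrightarrow>
      (\<exists>v\<in>verts G - X. C = component_of (delete_verts G X) v)" for C X
    using is_component_iff[OF simple_delete_verts[OF G]] by simp
  have Q_mono: "Q \<beta> \<Longrightarrow> \<beta> \<le> \<alpha> \<Longrightarrow> Q \<alpha>" for \<alpha> \<beta>
    unfolding Q_def by (meson order_less_le_trans)
  have Q_if: "Q \<beta>" if "has_rank I G \<beta>" for \<beta>
  proof (cases "\<beta> = 0")
    case True
    with that have "verts G \<in> I" by (simp add: has_rank.simps)
    then show ?thesis unfolding Q_def by (intro exI[of _ "verts G"]) auto
  next
    case False
    with that obtain X where X: "X \<subseteq> verts G" "X \<in> I"
      "\<forall>C. is_component C (delete_verts G X) \<longrightarrow> (\<exists>\<gamma><\<beta>. has_rank I C \<gamma>)"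
      using has_rank.simps[of I G \<beta>] by (metis (no_types, lifting))
    have "\<exists>\<gamma><\<beta>. rank_le I (component_of (delete_verts G X) v) \<gamma>" if "v \<in> verts G - X" for v
    proof -
      have "is_component (component_of (delete_verts G X) v) (delete_verts G X)"
        unfolding comp using that by blast
      with X(3) show ?thesis unfolding rank_le_def by blast
    qed
    then show ?thesis unfolding Q_def using X(1,2) by blast
  qed
  have "rank_le I G \<alpha>" if "Q \<alpha>"
  proof -
    \<comment> \<open>The least ordinal satisfying the recursive condition is the exact rank: a
      smaller rank would satisfy the condition too, by \<open>Q_if\<close>.\<close>
    define \<beta> where "\<beta> = (LEAST \<beta>. Q \<beta>)"
    have Q: "Q \<beta>" and le: "\<beta> \<le> \<alpha>" unfolding \<beta>_def using that by (auto intro: LeastI Least_le)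
    have min: "\<not> has_rank I G \<gamma>" if "\<gamma> < \<beta>" for \<gamma>
      using Q_if not_less_Least that unfolding \<beta>_def by blast
    obtain X where X: "X \<subseteq> verts G" "X \<in> I"
      "\<And>v. v \<in> verts G - X \<Longrightarrow> \<exists>\<gamma><\<beta>. rank_le I (component_of (delete_verts G X) v) \<gamma>"
      using Q unfolding Q_def by blast
    have "has_rank I G \<beta>"
    proof (cases "\<beta> = 0")
      case True
      \<comment> \<open>Nothing lies below 0, so no vertex outside \<open>X\<close> can
        exist.\<close>
      then have "verts G - X = {}" using X(3) by (meson all_not_in_conv leD zero_le_ordinal)
      then have "verts G = X" using X(1) by blast
      then show ?thesis using True X(2) by (simp add: has_rank.simps)
    next
      case False
      have "\<exists>\<gamma><\<beta>. has_rank I C \<gamma>" if "is_component C (delete_verts G X)" for C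
      proof -
        from that obtain v where v: "v \<in> verts G - X" "C = component_of (delete_verts G X) v"
          unfolding comp by blast
        then show ?thesis using X(3)[OF v(1)] unfolding rank_le_def v(2)
          by (meson order_le_less_trans)
      qed
      then have "\<exists>X. X \<subseteq> verts G \<and> X \<in> I \<and>
          (\<forall>C. is_component C (delete_verts G X) \<longrightarrow> (\<exists>\<gamma><\<beta>. has_rank I C \<gamma>))"
        using X(1,2) by blast
      with False min show ?thesis unfolding has_rank.simps[of I G \<beta>] by simp
    qed
    then show ?thesis using le unfolding rank_le_def by blast
  qed
  moreover have "Q \<alpha>" if "rank_le I G \<alpha>" using that Q_if Q_mono unfolding rank_le_def by blast
  ultimately show ?thesis unfolding Q_def[symmetric] by blast
qed

lemma ideal_finite: "ideal {A. finite A}"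
  unfolding ideal_def by (auto intro: finite_subset)

lemma ideal_subset: "ideal I \<Longrightarrow> A \<in> I \<Longrightarrow> B \<subseteq> A \<Longrightarrow> B \<in> I"
  unfolding ideal_def by blast

lemma ideal_Un: "ideal I \<Longrightarrow> A \<in> I \<Longrightarrow> B \<in> I \<Longrightarrow> A \<union> B \<in> I"
  unfolding ideal_def by blast

lemma ideal_UN: "finite X \<Longrightarrow> ideal I \<Longrightarrow> (\<And>t. t \<in> X \<Longrightarrow> A t \<in> I) \<Longrightarrow> (\<Union>t\<in>X. A t) \<in> I"
  by (induction X rule: finite_induct) (auto simp: ideal_def)


section \<open>From decompositions to ranks\<close>

text \<open>
  The path condition is replaced by connectedness of the set of nodes whose part contains a given
  vertex, and parts are intersected with \<^term>\<open>verts G\<close>: in this form the hypotheses pass to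
  components of \<^term>\<open>G\<close> and \<^term>\<open>T\<close> with the same \<^term>\<open>V\<close>.
\<close>

lemma rank_le_if_decomposition:
  fixes \<alpha> :: "'o ordinal" and G :: "'v ugraph" and T :: "'t ugraph"
  assumes I: "ideal I"
    and "simple_graph G" "simple_graph T" "rank_le {A. finite A} T \<alpha>"
    and "\<And>v. v \<in> verts G \<Longrightarrow> \<exists>t\<in>verts T. v \<in> V t"
    and "\<And>e. e \<in> edges G \<Longrightarrow> \<exists>t\<in>verts T. e \<subseteq> V t"
    and "\<And>v s t. v \<in> verts G \<Longrightarrow> s \<in> verts T \<Longrightarrow> t \<in> verts T \<Longrightarrow> v \<in> V s \<Longrightarrow> v \<in> V t
      \<Longrightarrow> reach (induced T {t. v \<in> V t}) s t"
    and "\<And>t. t \<in> verts T \<Longrightarrow> V t \<inter> verts G \<in> I"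
  shows "rank_le I G \<alpha>"
  using assms(2-)
proof (induction \<alpha> arbitrary: G T rule: less_induct)
  case (less \<alpha>)
  note G = less.prems(1) and T = less.prems(2)
  note covers = less.prems(4) and edge = less.prems(5) and conn = less.prems(6)
  obtain X where X: "X \<subseteq> verts T" "finite X" and
    XC: "\<And>t. t \<in> verts T - X \<Longrightarrow>
      \<exists>\<beta><\<alpha>. rank_le {A. finite A} (component_of (delete_verts T X) t) \<beta>"
    using less.prems(3) unfolding rank_le_iff[OF T ideal_finite] by auto
  \<comment> \<open>After passing to a component, the parts of \<open>V\<close> may contain vertices
    outside the current graph, hence the intersection.\<close>
  define Y where "Y = (\<Union>t\<in>X. V t \<inter> verts G)"
  have Y: "Y \<subseteq> verts G" "Y \<in> I"
    using ideal_UN[OF X(2) I, of "\<lambda>t. V t \<inter> verts G"] X(1) less.prems(7)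
    unfolding Y_def by (blast, blast)
  let ?G = "delete_verts G Y" and ?T = "delete_verts T X"
  have "\<exists>\<beta><\<alpha>. rank_le I (component_of ?G v) \<beta>" if v: "v \<in> verts G - Y" for v
  proof -
    obtain t where t: "t \<in> verts T" "v \<in> V t" using covers v by blast
    then have tX: "t \<in> verts T - X" using v unfolding Y_def by auto
    obtain \<beta> where \<beta>: "\<beta> < \<alpha>" "rank_le {A. finite A} (component_of ?T t) \<beta>"
      using XC[OF tX] by blast
    \<comment> \<open>A vertex \<open>u\<close> outside \<open>Y\<close> lies in no part indexed by
      \<open>X\<close>, so the walk given by \<open>conn\<close> through parts containing
      \<open>u\<close> survives the deletion of \<open>X\<close>.\<close>
    have avoid: "reach ?T s s'"
      if "u \<in> verts G - Y" "s \<in> verts T" "s' \<in> verts T" "u \<in> V s" "u \<in> V s'" for u s s'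
    proof -
      have "reach (induced T {t. u \<in> V t}) s s'" using conn that by blast
      moreover have "edges (induced T {t. u \<in> V t}) \<subseteq> edges ?T"
        using that(1) unfolding Y_def by auto
      ultimately show ?thesis by (rule reach_mono[rotated])
    qed
    \<comment> \<open>Invariant along a walk from \<open>v\<close>: all nodes whose parts contain
      the current vertex lie in the component of \<open>t\<close>. A part containing both ends of
      the next edge carries it over.\<close>
    have loc: "u \<in> verts G - Y \<and> (\<forall>s\<in>verts T. u \<in> V s \<longrightarrow> reach ?T t s)" if "reach ?G v u" for u
      using that unfolding reach_def[of ?G]
    proof (induction rule: rtranclp_induct)
      case base
      then show ?case using avoid v t by blast
    next
      case (step u w)
      then have e: "{u, w} \<in> edges G" and w: "w \<in> verts G - Y"
        using simple_graph_edgeD[OF simple_delete_verts[OF G], of u w] by auto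
      from edge[OF e] obtain s where s: "s \<in> verts T" "u \<in> V s" "w \<in> V s" by auto
      then show ?case using step.IH w avoid by (blast intro: reach_trans)
    qed
    let ?C = "component_of ?G v" and ?S = "component_of ?T t"
    have inS: "s \<in> verts ?S" if "u \<in> verts ?C" "s \<in> verts T" "u \<in> V s" for u s
    proof -
      have "reach ?T t s" using loc that by auto
      moreover from this have "s \<in> verts ?T"
        using reach_verts[OF simple_delete_verts[OF T]] tX by auto
      ultimately show ?thesis by simp
    qed
    have "rank_le I ?C \<beta>"
    proof (rule less.IH[OF \<beta>(1) _ _ \<beta>(2)])
      show "simple_graph ?C" "simple_graph ?S"
        using G T by (simp_all add: simple_component_of simple_delete_verts)
      show "\<exists>s\<in>verts ?S. u \<in> V s" if "u \<in> verts ?C" for u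
      proof -
        have "u \<in> verts G" using that by simp
        then show ?thesis using covers inS[OF that] by blast
      qed
      show "\<exists>s\<in>verts ?S. e \<subseteq> V s" if e: "e \<in> edges ?C" for e
      proof -
        obtain u w where uw: "e = {u, w}" "u \<in> verts ?C"
          by (rule simple_graphE[OF simple_component_of[OF simple_delete_verts[OF G]] e])
        have "e \<in> edges G" using e by simp
        then obtain s where s: "s \<in> verts T" "e \<subseteq> V s" using edge by blast
        then show ?thesis using inS[OF uw(2) s(1)] uw(1) by blast
      qed
      show "reach (induced ?S {t. u \<in> V t}) s s'"
        if u: "u \<in> verts ?C" and s: "s \<in> verts ?S" "s' \<in> verts ?S" "u \<in> V s" "u \<in> V s'" for u s s'
      proof -
        have "reach (induced T {t. u \<in> V t}) s s'" using conn u s by auto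
        \<comment> \<open>By \<open>inS\<close> all nodes whose parts contain \<open>u\<close>
          already lie in \<open>?S\<close>, so restricting \<open>T\<close> to \<open>?S\<close>
          loses none of these edges.\<close>
        moreover have "edges (induced T {t. u \<in> V t}) \<subseteq> edges (induced ?S {t. u \<in> V t})"
        proof
          fix e assume e: "e \<in> edges (induced T {t. u \<in> V t})"
          have eT: "e \<in> edges T" "e \<subseteq> {t. u \<in> V t}" using e by auto
          have "e \<subseteq> verts T" using simple_graphE[OF T eT(1)] by blast
          then have sub: "e \<subseteq> verts ?S" using eT(2) inS[OF u] by blast
          moreover have "e \<inter> X = {}" using sub by auto
          ultimately show "e \<in> edges (induced ?S {t. u \<in> V t})" using eT by auto
        qed
        ultimately show ?thesis by (rule reach_mono[rotated])
      qed
      show "V s \<inter> verts ?C \<in> I" if "s \<in> verts ?S" for s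
      proof -
        have "V s \<inter> verts G \<in> I" using that less.prems(7) by simp
        then show ?thesis by (rule ideal_subset[OF I]) auto
      qed
    qed
    with \<beta>(1) show ?thesis by blast
  qed
  then show ?case unfolding rank_le_iff[OF G I] using Y by blast
qed

text \<open>The path condition puts a vertex shared by the end parts of a path into every part along
  it, so the path is a walk among the nodes whose parts contain that vertex.\<close>

lemma tree_decomposition_rank_le:
  fixes \<alpha> :: "'o ordinal"
  assumes I: "ideal I" and G: "simple_graph G"
    and D: "rayless_decomposition_into I G T V"
    and r: "rank_le {A. finite A} T \<alpha>"
  shows "rank_le I G \<alpha>"
proof (rule rank_le_if_decomposition[OF I G _ r, where V = V])
  have td: "tree_decomposition G T V" and VI: "\<And>t. t \<in> verts T \<Longrightarrow> V t \<in> I"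
    using D unfolding rayless_decomposition_into_def by auto
  then show "simple_graph T" unfolding tree_decomposition_def is_tree_def by blast
  show "\<exists>t\<in>verts T. v \<in> V t" if "v \<in> verts G" for v
    using td that unfolding tree_decomposition_def by blast
  show "\<exists>t\<in>verts T. e \<subseteq> V t" if "e \<in> edges G" for e
    using td that unfolding tree_decomposition_def by blast
  show "V t \<inter> verts G \<in> I" if "t \<in> verts T" for t
    using VI[OF that] ideal_subset[OF I] by blast
  show "reach (induced T {t. v \<in> V t}) s t"
    if "s \<in> verts T" "t \<in> verts T" "v \<in> V s" "v \<in> V t" for v s t
  proof -
    have "connected_graph T" using td unfolding tree_decomposition_def is_tree_def by blast
    with that(1,2) obtain p where p: "is_path T p" "hd p = s" "last p = t"
      unfolding connected_graph_def by meson
    have "V (hd p) \<inter> V (last p) \<subseteq> V x" if "x \<in> set p" for x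
      using td p(1) that unfolding tree_decomposition_def by blast
    then have "v \<in> V x" if "x \<in> set p" for x
      using that \<open>v \<in> V s\<close> \<open>v \<in> V t\<close> unfolding p by blast
    then show ?thesis
      using reach_if_successively[of p T "{t. v \<in> V t}"] p unfolding is_path_def by auto
  qed
qed


section \<open>Rayless graphs\<close>

text \<open>The successor of an infinite cardinal is regular, so a family of at most as many
  ordinals as \<open>'o\<close> has elements is not cofinal. The embedding \<open>g\<close> bounds
  the size of the family.\<close>

lemma ex_strict_upper_bound_ordinal:
  fixes F :: "'o ordinal set" and f :: "'t \<Rightarrow> 'o ordinal"
  assumes "infinite (UNIV :: 't set)" "inj (g :: 't \<Rightarrow> 'o)"
  shows "\<exists>\<alpha>. \<forall>t. f t < \<alpha>"
proof -
  let ?r = "card_of (UNIV :: 'o set)"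
  let ?s = "cardSuc ?r"
  have r: "Card_order ?r" by (rule card_of_Card_order)
  have s: "Card_order ?s" by (rule cardSuc_Card_order[OF r])
  have "infinite (UNIV :: 'o set)"
    using assms by (metis finite_imageD finite_subset subset_UNIV)
  then have inf: "infinite (Field ?r)" by (simp add: Field_card_of)
  then have infs: "infinite (Field ?s)" using cardSuc_finite[OF r] by blast
  \<comment> \<open>The proper initial segments form an increasing chain;
    \<open>cardSuc_UNION\<close> is regularity in the form that a small subset of the union lies in
    one member.\<close>
  define As where "As i = {a :: 'o ordinal. (Rep_ordinal a, i) \<in> ?s \<and> Rep_ordinal a \<noteq> i}" for i
  have po: "trans ?s" "antisym ?s"
    using s unfolding card_order_on_def well_order_on_def linear_order_on_def
      partial_order_on_def preorder_on_def by auto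
  have chain: "relChain ?s As"
    unfolding relChain_def
  proof (intro allI impI subsetI)
    fix i j a assume "(i, j) \<in> ?s" "a \<in> As i"
    then show "a \<in> As j"
      using transD[OF po(1), of "Rep_ordinal a" i j] antisymD[OF po(2), of "Rep_ordinal a" i]
      unfolding As_def by blast
  qed
  \<comment> \<open>An infinite cardinal is a limit ordinal, so every element lies strictly below
    another one.\<close>
  have "f t \<in> (\<Union>i\<in>Field ?s. As i)" for t
    using infinite_Card_order_limit[OF s infs Rep_ordinal[of "f t"]] unfolding As_def by blast
  then have "range f \<subseteq> (\<Union>i\<in>Field ?s. As i)" by blast
  moreover have "ordLeq3 (card_of (range f)) ?r"
  proof -
    have "ordLeq3 (card_of (range f)) (card_of (UNIV :: 't set))" by (rule card_of_image)
    also have "ordLeq3 (card_of (UNIV :: 't set)) ?r"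
      using assms(2) card_of_ordLeq[of "UNIV :: 't set" "UNIV :: 'o set"] by blast
    finally show ?thesis .
  qed
  ultimately obtain i where i: "i \<in> Field ?s" "range f \<subseteq> As i"
    using cardSuc_UNION[OF r inf chain] by blast
  have R: "Rep_ordinal (Abs_ordinal i :: 'o ordinal) = i" by (rule Abs_ordinal_inverse[OF i(1)])
  have "f t < Abs_ordinal i" for t
  proof -
    have "f t \<in> As i" using i(2) by blast
    then have *: "(Rep_ordinal (f t), i) \<in> ?s" "Rep_ordinal (f t) \<noteq> i"
      unfolding As_def by simp_all
    have "f t \<le> Abs_ordinal i" unfolding less_eq_ordinal_def R by (rule *)
    moreover have "f t \<noteq> Abs_ordinal i" using *(2) R by metis
    ultimately show ?thesis unfolding less_ordinal_def by blast
  qed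
  then show ?thesis by blast
qed

text \<open>Take the vertex just before the first visit of the walk to \<open>v\<close>. This
  supplies the edge along which the ray in \<open>rayless_has_rank\<close> is continued.\<close>

lemma neighbour_in_component:
  assumes "reach G u v" "u \<noteq> v"
  shows "\<exists>w. reach (delete_verts G {v}) u w \<and> {v, w} \<in> edges G"
  using assms unfolding reach_def[of G]
proof (induction rule: converse_rtranclp_induct)
  case (step u u')
  show ?case
  proof (cases "u' = v")
    case True
    then show ?thesis using step.hyps by (intro exI[of _ u]) (auto simp: insert_commute)
  next
    case False
    then obtain w where w: "reach (delete_verts G {v}) u' w" "{v, w} \<in> edges G"
      using step.IH by blast
    have "reach (delete_verts G {v}) u u'" using step False by (intro reach_edge) auto
    then show ?thesis using w reach_trans by metis
  qed
qed simp

lemma rayless_has_rank: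
  fixes T :: "'t ugraph" and g :: "'t \<Rightarrow> 'o"
  assumes inf: "infinite (UNIV :: 't set)" and g: "inj g"
    and T: "simple_graph T" "rayless T"
  shows "\<exists>\<alpha> :: 'o ordinal. rank_le {A. finite A} T \<alpha>"
proof (rule ccontr)
  define bad where "bad H \<longleftrightarrow> (\<nexists>\<alpha> :: 'o ordinal. rank_le {A. finite A} H \<alpha>)" for H :: "'t ugraph"
  assume "\<nexists>\<alpha> :: 'o ordinal. rank_le {A. finite A} T \<alpha>"
  then have "bad T" unfolding bad_def .
  \<comment> \<open>Otherwise all components have ranks, and one strict bound for all of them,
    available because \<open>'t\<close> embeds into \<open>'o\<close>, would give \<open>H\<close> a
    rank.\<close>
  have bad_comp: "\<exists>v\<in>verts H - X. bad (component_of (delete_verts H X) v)"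
    if H: "simple_graph H" "bad H" and X: "finite X" "X \<subseteq> verts H" for H X
  proof (rule ccontr)
    assume "\<not> ?thesis"
    then obtain f :: "'t \<Rightarrow> 'o ordinal" where
      f: "\<And>v. v \<in> verts H - X \<Longrightarrow> rank_le {A. finite A} (component_of (delete_verts H X) v) (f v)"
      unfolding bad_def by (auto dest!: bchoice)
    obtain \<alpha> where "\<forall>t. f t < \<alpha>" using ex_strict_upper_bound_ordinal[OF inf g] by blast
    then have "\<exists>\<beta><\<alpha>. rank_le {A. finite A} (component_of (delete_verts H X) v) \<beta>"
      if "v \<in> verts H - X" for v using f[OF that] by blast
    then have "rank_le {A. finite A} H \<alpha>"
      unfolding rank_le_iff[OF H(1) ideal_finite] using X by (intro exI[of _ X]) simp
    then show False using H(2) unfolding bad_def by blast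
  qed
  \<comment> \<open>A state is a connected subgraph without rank together with the current vertex of
    the ray.\<close>
  define P where "P Hv \<longleftrightarrow> simple_graph (fst Hv) \<and> bad (fst Hv) \<and> snd Hv \<in> verts (fst Hv) \<and>
      is_subgraph (fst Hv) T \<and> (\<forall>u\<in>verts (fst Hv). reach (fst Hv) u (snd Hv))" for Hv
  \<comment> \<open>Staying off the current vertex from now on will make the ray injective.\<close>
  define R where "R Hv Hv' \<longleftrightarrow> verts (fst Hv') \<subseteq> verts (fst Hv) - {snd Hv} \<and>
      {snd Hv, snd Hv'} \<in> edges T" for Hv Hv' :: "'t ugraph \<times> 't"
  have comp_sub: "is_subgraph (component_of (delete_verts H X) v) T" if "is_subgraph H T" for H X v
    using that simple_component_of[OF simple_delete_verts, of H] unfolding is_subgraph_def by auto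
  have comp_conn: "reach (component_of H v) u w"
    if "reach H v u" "reach H v w" for H :: "'t ugraph" and u v w
    using that by (meson reach_component_of reach_sym reach_trans)
  have start: "\<exists>Hv. P Hv"
  proof -
    \<comment> \<open>Deleting the empty set selects a component, since \<open>T\<close> is not
      assumed to be connected.\<close>
    obtain v where v: "v \<in> verts T" "bad (component_of (delete_verts T {}) v)"
      using bad_comp[OF T(1) \<open>bad T\<close>, of "{}"] by auto
    have "P (component_of (delete_verts T {}) v, v)"
      using v T comp_sub[of T] comp_conn simple_component_of[OF simple_delete_verts[OF T(1)]]
      unfolding P_def by (simp add: is_subgraph_def)
    then show ?thesis by blast
  qed
  have "\<exists>Hv'. P Hv' \<and> R Hv Hv'" if "P Hv" for Hv
  proof -
    obtain H v where Hv: "Hv = (H, v)" by force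
    have H: "simple_graph H" "bad H" "v \<in> verts H" "is_subgraph H T"
      "\<And>u. u \<in> verts H \<Longrightarrow> reach H u v" using that unfolding P_def Hv by auto
    let ?H = "delete_verts H {v}"
    have sH: "simple_graph ?H" by (rule simple_delete_verts[OF H(1)])
    obtain u where u: "u \<in> verts H" "u \<noteq> v" "bad (component_of ?H u)"
      using bad_comp[OF H(1,2), of "{v}"] H(3) by auto
    obtain w where w: "reach ?H u w" "{v, w} \<in> edges H"
      using neighbour_in_component[OF H(5)[OF u(1)] u(2)] by blast
    have "w \<in> verts ?H" using reach_verts[OF sH w(1)] u by simp
    then have "P (component_of ?H u, w)"
      using u w comp_sub[OF H(4)] comp_conn[of ?H u _ w] simple_component_of[OF sH]
      unfolding P_def by simp
    moreover have "R Hv (component_of ?H u, w)"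
      using w H(4) unfolding R_def Hv is_subgraph_def by auto
    ultimately show ?thesis by blast
  qed
  then have "\<exists>F. \<forall>n. P (F n) \<and> R (F n) (F (Suc n))"
    using start by (intro dependent_nat_choice[of "\<lambda>_. P" "\<lambda>_. R"]) simp_all
  then obtain F where F: "\<And>n. P (F n)" "\<And>n. R (F n) (F (Suc n))" by blast
  define f where "f n = snd (F n)" for n
  have mem: "f n \<in> verts (fst (F n))" for n using F(1) unfolding P_def f_def by blast
  have nested: "verts (fst (F m)) \<subseteq> verts (fst (F n)) - {f n}" if "n < m" for n m
    using that
  proof (induction m)
    case (Suc m)
    have step: "verts (fst (F (Suc m))) \<subseteq> verts (fst (F m)) - {f m}"
      using F(2)[of m] unfolding R_def f_def by blast
    show ?case
    proof (cases "n = m")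
      case False
      then have "n < m" using Suc.prems by simp
      from Suc.IH[OF this] step show ?thesis by blast
    qed (use step in simp)
  qed simp
  have "f n \<noteq> f m" if "n < m" for n m using subsetD[OF nested[OF that] mem] by auto
  then have "inj f" by (intro linorder_injI)
  moreover have "f n \<in> verts T" for n
    using F(1)[of n] unfolding P_def f_def is_subgraph_def by blast
  moreover have "{f n, f (Suc n)} \<in> edges T" for n
    using F(2)[of n] unfolding R_def f_def by blast
  ultimately have "is_ray T f" unfolding is_ray_def by blast
  then show False using T(2) unfolding rayless_def by blast
qed

text \<open>A ray meets the finite set \<open>X\<close> only finitely often, so a tail of it lies in
  one component of \<open>T - X\<close>, which is rayless by induction.\<close>

lemma rayless_if_rank_le:
  fixes \<alpha> :: "'o ordinal" and T :: "'t ugraph"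
  assumes "simple_graph T" "rank_le {A. finite A} T \<alpha>"
  shows "rayless T"
  using assms
proof (induction \<alpha> arbitrary: T rule: less_induct)
  case (less \<alpha>)
  note T = less.prems(1)
  obtain X where X: "finite X" and
    XC: "\<And>t. t \<in> verts T - X \<Longrightarrow>
      \<exists>\<beta><\<alpha>. rank_le {A. finite A} (component_of (delete_verts T X) t) \<beta>"
    using less.prems(2) unfolding rank_le_iff[OF T ideal_finite] by auto
  show ?case unfolding rayless_def
  proof
    assume "\<exists>f. is_ray T f"
    then obtain f where f: "inj f" "\<And>n. f n \<in> verts T" "\<And>n. {f n, f (Suc n)} \<in> edges T"
      unfolding is_ray_def by blast
    have "finite (f -` X)" using X f(1) by (simp add: finite_vimageI)
    then obtain N where N: "\<forall>n\<in>f -` X. n < N"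
      using finite_nat_set_iff_bounded[of "f -` X"] by blast
    have out: "f (n + N) \<notin> X" for n using bspec[OF N, of "n + N"] by auto
    let ?T = "delete_verts T X"
    have e: "{f (n + N), f (Suc n + N)} \<in> edges ?T" for n
      using f(3)[of "n + N"] out[of n] out[of "Suc n"] by auto
    have r: "reach ?T (f N) (f (n + N))" for n
    proof (induction n)
      case (Suc n)
      from reach_trans[OF this reach_edge[OF e[of n]]] show ?case .
    qed simp
    have "inj (\<lambda>n. f (n + N))" by (intro injI) (simp add: inj_eq[OF f(1)])
    moreover have "f (n + N) \<in> verts (component_of ?T (f N))" for n using f(2) out r by simp
    moreover have "{f (n + N), f (Suc n + N)} \<in> edges (component_of ?T (f N))" for n
      using e[of n] r[of n] r[of "Suc n"] by simp
    ultimately have "is_ray (component_of ?T (f N)) (\<lambda>n. f (n + N))" unfolding is_ray_def by simp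
    moreover have "f N \<in> verts T - X" using f(2) out[of 0] by simp
    then obtain \<beta> where "\<beta> < \<alpha>" "rank_le {A. finite A} (component_of ?T (f N)) \<beta>"
      using XC by blast
    then have "rayless (component_of ?T (f N))"
      using less.IH simple_component_of[OF simple_delete_verts[OF T]] by blast
    ultimately show False unfolding rayless_def by blast
  qed
qed

section \<open>Trees of lists\<close>

definition prefix_closed :: "'a list set \<Rightarrow> bool" where
  "prefix_closed S \<longleftrightarrow> [] \<in> S \<and> (\<forall>l v. l @ [v] \<in> S \<longrightarrow> l \<in> S)"

text \<open>The embedding \<open>f\<close> lets the same lemmas treat three cases: the lists
  themselves (\<open>id\<close>), the copy below a child of the root (\<open>Cons a\<close>), and
  nodes taken from another type.\<close>

definition list_tree :: "('a list \<Rightarrow> 't) \<Rightarrow> 'a list set \<Rightarrow> 't ugraph" where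
  "list_tree f S = \<lparr>verts = f ` S, edges = {{f l, f (l @ [v])} | l v. l @ [v] \<in> S}\<rparr>"

definition list_adj :: "'a list set \<Rightarrow> 'a list \<Rightarrow> 'a list \<Rightarrow> bool" where
  "list_adj S x y \<longleftrightarrow> (\<exists>v. y = x @ [v] \<and> y \<in> S) \<or> (\<exists>v. x = y @ [v] \<and> x \<in> S)"

lemma verts_list_tree [simp]: "verts (list_tree f S) = f ` S"
  by (simp add: list_tree_def)

lemma edges_list_tree: "edges (list_tree f S) = {{f l, f (l @ [v])} | l v. l @ [v] \<in> S}"
  by (simp add: list_tree_def)

lemma list_adj_sym: "list_adj S x y \<longleftrightarrow> list_adj S y x"
  unfolding list_adj_def by blast

lemma list_tree_edge_iff:
  assumes "inj f"
  shows "{f x, f y} \<in> edges (list_tree f S) \<longleftrightarrow> list_adj S x y"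
proof
  assume "{f x, f y} \<in> edges (list_tree f S)"
  then obtain l v where l: "{f x, f y} = {f l, f (l @ [v])}" "l @ [v] \<in> S"
    unfolding edges_list_tree by blast
  then have "x = l \<and> y = l @ [v] \<or> x = l @ [v] \<and> y = l"
    using assms by (simp add: doubleton_eq_iff inj_eq)
  then show "list_adj S x y" using l(2) unfolding list_adj_def by blast
next
  assume "list_adj S x y"
  then show "{f x, f y} \<in> edges (list_tree f S)"
    unfolding list_adj_def edges_list_tree by (auto simp: insert_commute)
qed

lemma simple_list_tree:
  assumes "inj f" "prefix_closed S"
  shows "simple_graph (list_tree f S)"
  unfolding simple_graph_def
proof
  fix e assume "e \<in> edges (list_tree f S)"
  then obtain l v where l: "e = {f l, f (l @ [v])}" "l @ [v] \<in> S" unfolding edges_list_tree by blast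
  moreover have "f l \<noteq> f (l @ [v])" using inj_eq[OF assms(1), of l "l @ [v]"] by simp
  moreover have "l \<in> S" using l(2) assms(2) unfolding prefix_closed_def by blast
  ultimately show "\<exists>x\<in>verts (list_tree f S). \<exists>y\<in>verts (list_tree f S). x \<noteq> y \<and> e = {x, y}"
    unfolding verts_list_tree by blast
qed

lemma connected_list_tree:
  assumes "inj f" "prefix_closed S"
  shows "connected_graph (list_tree f S)"
proof -
  have r: "l \<in> S \<Longrightarrow> reach (list_tree f S) (f []) (f l)" for l
  proof (induction l rule: rev_induct)
    case (snoc v l)
    then have "l \<in> S" using assms(2) unfolding prefix_closed_def by blast
    moreover have "{f l, f (l @ [v])} \<in> edges (list_tree f S)"
      using snoc.prems unfolding edges_list_tree by blast
    ultimately show ?case using snoc.IH by (meson reach_edge reach_trans)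
  qed simp
  have "reach (list_tree f S) (f x) (f y)" if "x \<in> S" "y \<in> S" for x y
    using reach_trans[OF reach_sym[OF r[OF that(1)]] r[OF that(2)]] .
  moreover have "[] \<in> S" using assms(2) unfolding prefix_closed_def by blast
  ultimately show ?thesis unfolding connected_graph_iff[OF simple_list_tree[OF assms]] by auto
qed

lemma path_list_treeE:
  assumes "inj f" "is_path (list_tree f S) p"
  obtains q where "p = map f q" "q \<noteq> []" "distinct q" "set q \<subseteq> S" "successively (list_adj S) q"
proof -
  have p: "p \<noteq> []" "distinct p" "set p \<subseteq> f ` S"
    "successively (\<lambda>u v. {u, v} \<in> edges (list_tree f S)) p"
    using assms(2) unfolding is_path_def by auto
  have "p = map f (map (inv f) p)" using p(3) by (auto intro!: map_idI[symmetric] simp: assms(1))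
  moreover define q where "q = map (inv f) p"
  ultimately have q: "p = map f q" by simp
  have "set q \<subseteq> S" using p(3) assms(1) unfolding q by (auto simp: inj_image_subset_iff)
  moreover have "successively (list_adj S) q"
    using p(4) unfolding q by (simp add: successively_map list_tree_edge_iff[OF assms(1)])
  ultimately show ?thesis using that q p(1,2) by (auto simp: distinct_map)
qed

lemma acyclic_list_tree:
  assumes "inj f"
  shows "\<not> is_cycle (list_tree f S) c"
proof
  assume c: "is_cycle (list_tree f S) c"
  then obtain q where q: "c = map f q" "q \<noteq> []" "distinct q" "successively (list_adj S) q"
    using path_list_treeE[OF assms] unfolding is_cycle_def by metis
  have len: "length q \<ge> 3" using c q(1) unfolding is_cycle_def by simp
  have close: "list_adj S (last q) (hd q)"
    using c q(1,2) list_tree_edge_iff[OF assms] unfolding is_cycle_def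
    by (simp add: last_map hd_map)
  \<comment> \<open>both neighbours on the cycle of a longest list \<^term>\<open>m\<close> are its parent\<close>
  have "Max (length ` set q) \<in> length ` set q" using q(2) by (intro Max_in) auto
  then obtain m where m: "m \<in> set q" "length m = Max (length ` set q)" by force
  then have longest: "length y \<le> length m" if "y \<in> set q" for y using that by simp
  have parent: "y = butlast m" if "y \<in> set q" "list_adj S m y" for y
    using longest[OF that(1)] that(2) unfolding list_adj_def by auto
  obtain a b where ab: "q = a @ m # b" using m(1) by (meson split_list)
  \<comment> \<open>The cycle read from just after \<open>m\<close> round to just before it: the
    ends of \<open>w\<close> are the two neighbours of \<open>m\<close>, which are different because
    \<open>w\<close> has at least two entries.\<close>
  define w where "w = b @ a"
  have w: "length w \<ge> 2" "distinct w" "set w \<subseteq> set q" using len q(3) unfolding w_def ab by auto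
  then have w0: "w \<noteq> []" by auto
  \<comment> \<open>If \<open>b\<close> is empty, the successor of \<open>m\<close> is
    \<open>hd q\<close>, and the closing edge supplies the adjacency.\<close>
  have "list_adj S m (hd w)"
    using q(4) close w0 unfolding ab w_def
    by (cases b) (auto simp: successively_append_iff)
  moreover have "list_adj S m (last w)"
    using q(4) close w0 unfolding ab w_def list_adj_sym[of S m]
    by (cases a rule: rev_cases) (auto simp: successively_append_iff)
  ultimately have "hd w = last w" using parent w(3) w0 by (metis hd_in_set last_in_set subsetD)
  moreover obtain x y zs where "w = x # y # zs"
    using w(1) by (metis One_nat_def Suc_1 Suc_le_length_iff)
  ultimately show False using w(2) by (auto split: if_splits)
qed

lemma is_tree_list_tree: "inj f \<Longrightarrow> prefix_closed S \<Longrightarrow> is_tree (list_tree f S)"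
  unfolding is_tree_def using simple_list_tree connected_list_tree acyclic_list_tree by blast

text \<open>Among the lists extending \<open>r\<close>, only \<open>r\<close> itself can be adjacent
  to a list not extending \<open>r\<close>.\<close>

lemma leaves_subtree_through_root:
  assumes "successively (list_adj S) q" "q \<noteq> []" "prefix r (hd q)" "\<not> prefix r (last q)"
  shows "r \<in> set q"
  using assms
proof (induction q rule: induct_list012)
  case (3 x y zs)
  show ?case
  proof (cases "prefix r y")
    case True
    then show ?thesis using 3 by auto
  next
    case False
    moreover have "list_adj S x y" "prefix r x" using 3 by auto
    ultimately have "r = x" unfolding list_adj_def by auto
    then show ?thesis by simp
  qed
qed auto

text \<open>A path that starts and ends below \<open>r\<close> but visits some \<open>t\<close>
  elsewhere would pass \<open>r\<close> both before and after \<open>t\<close>.\<close>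

lemma subtree_convex:
  assumes q: "successively (list_adj S) q" "distinct q"
    and r: "prefix r (hd q)" "prefix r (last q)" and t: "t \<in> set q"
  shows "prefix r t"
proof (rule ccontr)
  assume n: "\<not> prefix r t"
  then have "r \<noteq> t" by auto
  obtain a b where ab: "q = a @ t # b" using t by (meson split_list)
  have "r \<in> set (a @ [t])"
  proof (rule leaves_subtree_through_root)
    show "successively (list_adj S) (a @ [t])"
      using q(1) unfolding ab by (auto simp: successively_append_iff)
    show "prefix r (hd (a @ [t]))" using r(1) unfolding ab by (cases a) auto
  qed (use n in auto)
  \<comment> \<open>The second half is read backwards, so that it also starts below \<open>r\<close>
    and ends at \<open>t\<close>.\<close>
  moreover have "r \<in> set (rev (t # b))"
  proof (rule leaves_subtree_through_root)
    have "successively (list_adj S) (t # b)"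
      using q(1) unfolding ab by (auto simp: successively_append_iff)
    then show "successively (list_adj S) (rev (t # b))"
      unfolding successively_rev by (subst list_adj_sym)
    have "hd (rev (t # b)) = last q" unfolding ab hd_rev by simp
    then show "prefix r (hd (rev (t # b)))" using r(2) by simp
    show "\<not> prefix r (last (rev (t # b)))" using n by simp
  qed simp
  ultimately show False using q(2) \<open>r \<noteq> t\<close> unfolding ab by auto
qed

text \<open>
  The bags consisting of a node and its parent turn the tree itself into a decomposition of any of
  its embedded copies.
\<close>

lemma rank_le_list_tree:
  fixes \<alpha> :: "'o ordinal"
  assumes S: "prefix_closed S" "rank_le {A. finite A} (list_tree id S) \<alpha>"
    and f: "inj f"
    and D: "simple_graph D" "verts D \<subseteq> f ` S" "edges D \<subseteq> edges (list_tree f S)"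
  shows "rank_le {A. finite A} D \<alpha>"
proof (rule rank_le_if_decomposition[OF ideal_finite D(1) _ S(2),
      where V = "\<lambda>l. {f l, f (butlast l)}"])
  let ?V = "\<lambda>l. {f l, f (butlast l)}"
  show "simple_graph (list_tree id S)" by (rule simple_list_tree[OF inj_on_id S(1)])
  show "\<exists>t\<in>verts (list_tree id S). v \<in> ?V t" if "v \<in> verts D" for v
    using that D(2) by auto
  show "\<exists>t\<in>verts (list_tree id S). e \<subseteq> ?V t" if "e \<in> edges D" for e
  proof -
    from that obtain l v where "e = {f l, f (l @ [v])}" "l @ [v] \<in> S"
      using D(3) unfolding edges_list_tree by blast
    then show ?thesis by (intro bexI[of _ "l @ [v]"]) auto
  qed
  show "reach (induced (list_tree id S) {t. v \<in> ?V t}) s t"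
    if v: "v \<in> verts D" and st: "s \<in> verts (list_tree id S)" "t \<in> verts (list_tree id S)"
      "v \<in> ?V s" "v \<in> ?V t" for v s t
  proof -
    obtain x where x: "v = f x" using v D(2) by blast
    \<comment> \<open>The nodes whose bag contains \<open>f x\<close> are \<open>x\<close> and its
      children, all joined to \<open>x\<close>. The root is treated apart because
      \<open>butlast [] = []\<close>.\<close>
    have "reach (induced (list_tree id S) {t. v \<in> ?V t}) x s" if "s \<in> S" "v \<in> ?V s" for s
    proof (cases "s = x \<or> s = []")
      case True
      then show ?thesis using that(2) f unfolding x by (auto simp: inj_eq)
    next
      case False
      then have "x = butlast s" using that(2) f unfolding x by (auto simp: inj_eq)
      with False have s: "s = x @ [last s]" by simp
      have "{x, s} \<in> edges (list_tree id S)"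
        using that(1) s unfolding edges_list_tree by (metis (mono_tags, lifting) CollectI id_apply)
      then show ?thesis using that(2) by (intro reach_edge) (simp add: x)
    qed
    then show ?thesis using st by (auto intro: reach_trans reach_sym)
  qed
qed simp


section \<open>From ranks to decompositions\<close>

text \<open>The nodes whose parts contain a vertex are required to be all nodes of \<open>S\<close>
  extending some \<open>r\<close>, which is more than convexity. Adding a new root and adding
  \<open>X\<close> to every part both preserve this form.\<close>

definition list_decomposition :: "'v set set \<Rightarrow> 'v ugraph \<Rightarrow> 'v list set \<Rightarrow> ('v list \<Rightarrow> 'v set) \<Rightarrow> bool"
  where "list_decomposition I G S V \<longleftrightarrow> prefix_closed S
    \<and> (\<forall>l\<in>S. V l \<in> I \<and> V l \<subseteq> verts G)
    \<and> (\<forall>x\<in>verts G. \<exists>r\<in>S. \<forall>l\<in>S. x \<in> V l \<longleftrightarrow> prefix r l)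
    \<and> (\<forall>e\<in>edges G. \<exists>l\<in>S. e \<subseteq> V l)"

text \<open>
  The children of the root are indexed by representatives of the components of \<^term>\<open>G - X\<close>, and
  \<^term>\<open>X\<close> is added to all parts of the decompositions of the components.
\<close>

lemma ex_list_decomposition:
  fixes \<alpha> :: "'o ordinal"
  assumes I: "ideal I" and "simple_graph G" "rank_le I G \<alpha>"
  shows "\<exists>S V. list_decomposition I G S V \<and> rank_le {A. finite A} (list_tree id S) \<alpha>"
  using assms(2-)
proof (induction \<alpha> arbitrary: G rule: less_induct)
  case (less \<alpha>)
  note G = less.prems(1)
  obtain X where X: "X \<subseteq> verts G" "X \<in> I" and
    XC: "\<And>v. v \<in> verts G - X \<Longrightarrow> \<exists>\<beta><\<alpha>. rank_le I (component_of (delete_verts G X) v) \<beta>"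
    using less.prems(2) unfolding rank_le_iff[OF G I] by auto
  define H where "H = delete_verts G X"
  have H: "simple_graph H" unfolding H_def by (rule simple_delete_verts[OF G])
  have vH: "verts H = verts G - X" and eH: "edges H = {e \<in> edges G. e \<inter> X = {}}"
    unfolding H_def by simp_all
  have "\<forall>v\<in>verts H. \<exists>\<beta> S V. \<beta> < \<alpha> \<and> list_decomposition I (component_of H v) S V
      \<and> rank_le {A. finite A} (list_tree id S) \<beta>"
  proof
    fix v assume "v \<in> verts H"
    then obtain \<beta> where "\<beta> < \<alpha>" "rank_le I (component_of H v) \<beta>"
      using XC unfolding H_def by auto
    with less.IH[OF _ simple_component_of[OF H]]
    show "\<exists>\<beta> S V. \<beta> < \<alpha> \<and> list_decomposition I (component_of H v) S V
      \<and> rank_le {A. finite A} (list_tree id S) \<beta>" by meson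
  qed
  then obtain b S V where IH: "\<And>v. v \<in> verts H \<Longrightarrow> b v < \<alpha>"
    "\<And>v. v \<in> verts H \<Longrightarrow> list_decomposition I (component_of H v) (S v) (V v)"
    "\<And>v. v \<in> verts H \<Longrightarrow> rank_le {A. finite A} (list_tree id (S v)) (b v)"
    unfolding bchoice_iff by blast
  \<comment> \<open>\<open>rep\<close> is constant on each component of \<open>H\<close>, so
    \<open>R\<close> contains exactly one index per component.\<close>
  define rep where "rep v = (SOME u. reach H v u)" for v
  have rep: "reach H v (rep v)" for v
    unfolding rep_def by (rule someI[of _ v]) simp
  have rep_eq: "rep v = rep w" if "reach H v w" for v w
  proof -
    have "reach H v = reach H w" using that by (intro ext) (meson reach_sym reach_trans)
    then show ?thesis unfolding rep_def by simp
  qed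
  define R where "R = rep ` verts H"
  have R_verts: "a \<in> verts H" if "a \<in> R" for a
    using that reach_verts[OF H rep] unfolding R_def by auto
  have R_rep: "rep a = a" if "a \<in> R" for a
    using that rep_eq[OF rep] unfolding R_def by auto
  define S' where "S' = insert [] {a # l | a l. a \<in> R \<and> l \<in> S a}"
  define V' where "V' l = (case l of [] \<Rightarrow> X | a # l \<Rightarrow> X \<union> V a l)" for l
  have V'_simps [simp]: "V' [] = X" "V' (a # l) = X \<union> V a l" for a l
    unfolding V'_def by simp_all
  have root_in: "[] \<in> S'" unfolding S'_def by simp
  have child_iff: "a # l \<in> S' \<longleftrightarrow> a \<in> R \<and> l \<in> S a" for a l unfolding S'_def by simp
  have Spc: "prefix_closed (S a)" if "a \<in> R" for a
    using IH(2)[OF R_verts[OF that]] unfolding list_decomposition_def by blast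
  \<comment> \<open>By the last claim a vertex of \<open>H\<close> occurs only in the branch indexed
    by its own component.\<close>
  have SV: "V a l \<in> I" "V a l \<subseteq> verts G - X" "\<And>x. x \<in> V a l \<Longrightarrow> rep x = a"
    if "a \<in> R" "l \<in> S a" for a l
  proof -
    have *: "V a l \<in> I" "V a l \<subseteq> verts (component_of H a)"
      using IH(2)[OF R_verts[OF that(1)]] that(2) unfolding list_decomposition_def by auto
    then show "V a l \<in> I" "V a l \<subseteq> verts G - X" using vH by auto
    fix x assume "x \<in> V a l"
    then have "reach H a x" using * by auto
    then show "rep x = a" using rep_eq R_rep that(1) by metis
  qed
  have comp_root: "\<exists>r\<in>S (rep x). \<forall>l\<in>S (rep x). x \<in> V (rep x) l \<longleftrightarrow> prefix r l"
    if "x \<in> verts H" for x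
  proof -
    have "rep x \<in> verts H" using R_verts that unfolding R_def by blast
    moreover have "x \<in> verts (component_of H (rep x))" using that reach_sym[OF rep] by simp
    ultimately show ?thesis using IH(2) unfolding list_decomposition_def by blast
  qed
  have pc: "prefix_closed S'"
    unfolding prefix_closed_def
  proof (intro conjI allI impI)
    fix l v assume lv: "l @ [v] \<in> S'"
    show "l \<in> S'"
    proof (cases l)
      case (Cons a l')
      then have "a \<in> R" "l' @ [v] \<in> S a" using lv child_iff by auto
      then have "l' \<in> S a" using Spc unfolding prefix_closed_def by blast
      then show ?thesis using \<open>a \<in> R\<close> Cons child_iff by simp
    qed (simp add: root_in)
  qed (rule root_in)
  have "list_decomposition I G S' V'"
    unfolding list_decomposition_def
  proof (intro conjI ballI)
    fix l assume l: "l \<in> S'"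
    show "V' l \<in> I" using l X(2) SV(1) I by (cases l) (auto simp: child_iff intro: ideal_Un)
    show "V' l \<subseteq> verts G" using l X(1) SV(2) by (cases l) (auto simp: child_iff)
  next
    fix x assume x: "x \<in> verts G"
    show "\<exists>r\<in>S'. \<forall>l\<in>S'. x \<in> V' l \<longleftrightarrow> prefix r l"
    proof (cases "x \<in> X")
      case True
      \<comment> \<open>\<open>X\<close> lies in every part, so a vertex of \<open>X\<close> has the
        whole tree as its subtree.\<close>
      then show ?thesis using root_in by (intro bexI[of _ "[]"]) (auto simp: V'_def split: list.splits)
    next
      case False
      then have xH: "x \<in> verts H" using x vH by simp
      then obtain r where r: "r \<in> S (rep x)" "\<And>l. l \<in> S (rep x) \<Longrightarrow> x \<in> V (rep x) l \<longleftrightarrow> prefix r l"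
        using comp_root by blast
      have rR: "rep x \<in> R" using xH unfolding R_def by simp
      have "x \<in> V' l \<longleftrightarrow> prefix (rep x # r) l" if "l \<in> S'" for l
      proof (cases l)
        case Nil
        then show ?thesis using False by simp
      next
        case (Cons c l')
        then have "c \<in> R" "l' \<in> S c" using that child_iff by auto
        then show ?thesis using r(2) SV(3) False Cons by auto
      qed
      then show ?thesis using r(1) rR child_iff by blast
    qed
  next
    fix e assume e: "e \<in> edges G"
    show "\<exists>l\<in>S'. e \<subseteq> V' l"
    proof (cases "e \<subseteq> X")
      case True
      then show ?thesis using root_in by (intro bexI[of _ "[]"]) auto
    next
      case False
      \<comment> \<open>Given an end \<open>z\<close> outside \<open>X\<close>, the other end lies
        in \<open>X\<close>, hence in every part, or in the same component of \<open>H\<close> as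
        \<open>z\<close>.\<close>
      then obtain z where z: "z \<in> e" "z \<notin> X" by blast
      obtain p q where pq: "e = {p, q}" "p \<in> verts G" "q \<in> verts G"
        by (rule simple_graphE[OF G e])
      define w where "w = (if z = p then q else p)"
      have w: "e = {z, w}" "w \<in> verts G" "z \<in> verts G"
        using pq z(1) unfolding w_def by auto
      have zH: "z \<in> verts H" using z w vH by simp
      then have zR: "rep z \<in> R" unfolding R_def by simp
      have "\<exists>l\<in>S (rep z). e \<subseteq> X \<union> V (rep z) l"
      proof (cases "w \<in> X")
        case True
        obtain r where "r \<in> S (rep z)" "z \<in> V (rep z) r" using comp_root[OF zH] by auto
        then show ?thesis using True w(1) by (intro bexI[of _ r]) auto
      next
        case False
        then have eH': "e \<in> edges H" using e eH z w by simp
        have "reach H (rep z) z" by (rule reach_sym[OF rep])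
        moreover have "reach H z w" using eH' w(1) by (simp add: reach_edge)
        ultimately have "reach H (rep z) w" by (rule reach_trans)
        with \<open>reach H (rep z) z\<close> have "e \<in> edges (component_of H (rep z))"
          using eH' w(1) by simp
        then obtain l where "l \<in> S (rep z)" "e \<subseteq> V (rep z) l"
          using IH(2)[OF R_verts[OF zR]] unfolding list_decomposition_def by blast
        then show ?thesis by (intro bexI[of _ l]) auto
      qed
      then obtain l where "l \<in> S (rep z)" "e \<subseteq> X \<union> V (rep z) l" by blast
      then show ?thesis using zR child_iff by (intro bexI[of _ "rep z # l"]) simp_all
    qed
  qed (rule pc)
  moreover have "rank_le {A. finite A} (list_tree id S') \<alpha>"
    unfolding rank_le_iff[OF simple_list_tree[OF inj_on_id pc] ideal_finite]
  proof (intro exI[of _ "{[]}"] conjI ballI)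
    fix t assume "t \<in> verts (list_tree id S') - {[]}"
    then obtain a l where t: "t = a # l" and a: "a \<in> R" "l \<in> S a"
      by (cases t) (auto simp: child_iff)
    let ?T = "delete_verts (list_tree id S') {[]}"
    let ?D = "component_of ?T t"
    have T: "simple_graph ?T" by (rule simple_delete_verts[OF simple_list_tree[OF inj_on_id pc]])
    \<comment> \<open>Different branches are joined only through \<open>[]\<close>, so walks
      avoiding it keep the first entry \<open>a\<close>.\<close>
    have in_copy: "u \<in> Cons a ` S a" if "reach ?T t u" for u
      using that unfolding reach_def
    proof (induction rule: rtranclp_induct)
      case base
      then show ?case using t a by simp
    next
      case (step y z)
      then have yz: "list_adj S' y z" "z \<noteq> []"
        using list_tree_edge_iff[of id y z S'] by auto
      from step.IH obtain l' where l': "y = a # l'" "l' \<in> S a" by blast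
      from yz obtain z' where z': "z = a # z'" unfolding list_adj_def l' by (cases z) auto
      have "z \<in> S'"
        using yz(1) pc unfolding list_adj_def prefix_closed_def by blast
      then show ?case using z' child_iff by simp
    qed
    \<comment> \<open>\<open>?D\<close> is not identified with the tree on \<open>S a\<close>; lying
      inside its copy under \<open>Cons a\<close> already bounds the rank.\<close>
    have "rank_le {A. finite A} ?D (b a)"
    proof (rule rank_le_list_tree[OF Spc[OF a(1)] IH(3)[OF R_verts[OF a(1)]], of "Cons a"])
      show "simple_graph ?D" by (rule simple_component_of[OF T])
      show "verts ?D \<subseteq> Cons a ` S a" using in_copy by auto
      show "edges ?D \<subseteq> edges (list_tree (Cons a) (S a))"
      proof
        fix e assume e: "e \<in> edges ?D"
        then have "e \<in> edges (list_tree id S')" by simp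
        then obtain k v where k: "e = {k, k @ [v]}" unfolding edges_list_tree by auto
        then have "k \<in> Cons a ` S a" "k @ [v] \<in> Cons a ` S a" using in_copy e by auto
        then obtain k' where "k = a # k'" "k' @ [v] \<in> S a" by auto
        then show "e \<in> edges (list_tree (Cons a) (S a))"
          unfolding k edges_list_tree by (intro CollectI exI[of _ k'] exI[of _ v]) simp
      qed
    qed simp
    then show "\<exists>\<beta><\<alpha>. rank_le {A. finite A} ?D \<beta>" using IH(1)[OF R_verts[OF a(1)]] by blast
  qed (use root_in in simp_all)
  ultimately show ?case by blast
qed

section \<open>Transfer to the node type \<open>'t\<close> and the minimum formula\<close>

lemma inj_list_into_infinite:
  assumes "infinite (UNIV :: 't set)" "inj (f :: 'v \<Rightarrow> 't)"
  shows "\<exists>h :: 'v list \<Rightarrow> 't. inj h"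
proof -
  \<comment> \<open>An infinite type absorbs its square; iterating the resulting pairing
    \<open>g\<close> codes lists.\<close>
  have "ordLeq3 (card_of ((UNIV :: 't set) \<times> (UNIV :: 't set))) (card_of (UNIV :: 't set))"
    using card_of_Times_same_infinite[OF assms(1)] ordIso_iff_ordLeq by blast
  then obtain g :: "'t \<times> 't \<Rightarrow> 't" where g: "inj g"
    using card_of_ordLeq[of "UNIV \<times> UNIV :: ('t \<times> 't) set" "UNIV :: 't set"] by auto
  obtain k :: "nat \<Rightarrow> 't" where k: "inj k"
    using assms(1) infinite_iff_countable_subset[of "UNIV :: 't set"] by blast
  \<comment> \<open>The start value \<open>k 0\<close> is arbitrary, and \<open>c\<close> separates
    only lists of equal length; the length, coded by \<open>k\<close>, is therefore paired with it
    below.\<close>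
  define c where "c l = foldr (\<lambda>a t. g (f a, t)) l (k 0)" for l
  have c: "length l = length l' \<Longrightarrow> c l = c l' \<Longrightarrow> l = l'" for l l'
    unfolding c_def by (induction l l' rule: list_induct2)
      (use g assms(2) in \<open>auto simp: inj_eq\<close>)
  have "inj (\<lambda>l. g (k (length l), c l))"
    by (intro injI) (use g k c in \<open>auto simp: inj_eq\<close>)
  then show ?thesis by blast
qed

text \<open>The path condition holds because the nodes whose parts contain a given vertex form a
  subtree, convex by \<open>subtree_convex\<close>. Raylessness comes from the rank bound.\<close>

lemma rayless_decomposition_list_tree:
  fixes \<alpha> :: "'o ordinal"
  assumes f: "inj f" and D: "list_decomposition I G S V"
    and r: "rank_le {A. finite A} (list_tree id S) \<alpha>"
  shows "rayless_decomposition_into I G (list_tree f S) (\<lambda>t. V (inv f t))"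
    and "rank_le {A. finite A} (list_tree f S) \<alpha>"
proof -
  have pc: "prefix_closed S" and SI: "\<And>l. l \<in> S \<Longrightarrow> V l \<in> I" and SG: "\<And>l. l \<in> S \<Longrightarrow> V l \<subseteq> verts G"
    and root: "\<And>x. x \<in> verts G \<Longrightarrow> \<exists>r\<in>S. \<forall>l\<in>S. x \<in> V l \<longleftrightarrow> prefix r l"
    and edge: "\<And>e. e \<in> edges G \<Longrightarrow> \<exists>l\<in>S. e \<subseteq> V l"
    using D unfolding list_decomposition_def by auto
  show rk: "rank_le {A. finite A} (list_tree f S) \<alpha>"
    by (rule rank_le_list_tree[OF pc r f simple_list_tree[OF f pc]]) simp_all
  have "tree_decomposition G (list_tree f S) (\<lambda>t. V (inv f t))"
    unfolding tree_decomposition_def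
  proof (intro conjI allI impI ballI)
    show "is_tree (list_tree f S)" by (rule is_tree_list_tree[OF f pc])
    have "x \<in> (\<Union>l\<in>S. V l)" if "x \<in> verts G" for x using root[OF that] by blast
    then show "(\<Union>t\<in>verts (list_tree f S). V (inv f t)) = verts G" using SG f by auto
    show "\<exists>t\<in>verts (list_tree f S). e \<subseteq> V (inv f t)" if "e \<in> edges G" for e
      using edge[OF that] f by simp
    show "V (inv f (hd p)) \<inter> V (inv f (last p)) \<subseteq> V (inv f t)"
      if p: "is_path (list_tree f S) p" and t: "t \<in> set p" for p t
    proof
      obtain q where q: "p = map f q" "q \<noteq> []" "distinct q" "set q \<subseteq> S" "successively (list_adj S) q"
        using path_list_treeE[OF f p] .
      obtain s where s: "t = f s" "s \<in> set q" using t q(1) by auto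
      have ends: "hd q \<in> S" "last q \<in> S" "s \<in> S" using q(2,4) s(2) by auto
      fix x assume "x \<in> V (inv f (hd p)) \<inter> V (inv f (last p))"
      then have x: "x \<in> V (hd q)" "x \<in> V (last q)"
        using q(1,2) f by (simp_all add: hd_map last_map)
      then obtain r where r: "\<And>l. l \<in> S \<Longrightarrow> x \<in> V l \<longleftrightarrow> prefix r l"
        using root SG[OF ends(1)] by blast
      have "prefix r s"
        by (rule subtree_convex[OF q(5,3) _ _ s(2)]) (use r ends x in simp_all)
      then show "x \<in> V (inv f t)" using r ends(3) s(1) f by simp
    qed
  qed
  then show "rayless_decomposition_into I G (list_tree f S) (\<lambda>t. V (inv f t))"
    unfolding rayless_decomposition_into_def
    using rayless_if_rank_le[OF simple_list_tree[OF f pc] rk] SI f by auto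
qed

text \<open>The assumptions on \<open>'t\<close> leave room for all lists of vertices as nodes; the
  embedding into \<open>'o\<close> provides enough ordinals to rank every rayless tree on
  \<open>'t\<close>.\<close>

theorem theorem3p1:
  fixes G :: "'v ugraph" and I :: "'v set set"
  assumes "simple_graph G" and "ideal I"
    and "infinite (UNIV :: 't set)"
    and "\<exists>f :: 'v \<Rightarrow> 't. inj f" and "\<exists>g :: 't \<Rightarrow> 'o. inj g"
  shows "((\<exists>\<alpha> :: 'o ordinal. has_rank I G \<alpha>) \<longleftrightarrow> traceable TYPE('t) I G)
    \<and> ((\<exists>\<alpha> :: 'o ordinal. has_rank I G \<alpha>) \<and> traceable TYPE('t) I G \<longrightarrow>
         (rank_of I G :: 'o ordinal) =
           (LEAST \<rho>. \<rho> \<in> {aleph0_rank T | (T :: 't ugraph) V. rayless_decomposition_into I G T V}))"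
proof -
  obtain g :: "'t \<Rightarrow> 'o" where g: "inj g" using assms(5) by blast
  obtain h :: "'v list \<Rightarrow> 't" where h: "inj h" using inj_list_into_infinite assms(3,4) by blast
  have to_tree: "\<exists>(T :: 't ugraph) V. rayless_decomposition_into I G T V \<and> rank_le {A. finite A} T \<alpha>"
    if rk: "rank_le I G \<alpha>" for \<alpha> :: "'o ordinal"
  proof -
    obtain S V where SV: "list_decomposition I G S V" "rank_le {A. finite A} (list_tree id S) \<alpha>"
      using ex_list_decomposition[OF assms(2,1) rk] by blast
    from rayless_decomposition_list_tree[OF h SV] show ?thesis by blast
  qed
  \<comment> \<open>A rayless tree has a rank, so \<open>aleph0_rank T\<close> is its actual rank
    and not an unspecified value.\<close>
  have from_tree: "rank_le I G (aleph0_rank T :: 'o ordinal)"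
      "rank_le {A. finite A} T \<alpha> \<longleftrightarrow> aleph0_rank T \<le> \<alpha>"
    if D: "rayless_decomposition_into I G T V"
    for T :: "'t ugraph" and V and \<alpha> :: "'o ordinal"
  proof -
    have "simple_graph T" "rayless T"
      using D unfolding rayless_decomposition_into_def tree_decomposition_def is_tree_def by auto
    then obtain \<beta> :: "'o ordinal" where "rank_le {A. finite A} T \<beta>"
      using rayless_has_rank[OF assms(3) g] by blast
    then have rk: "rank_le {A. finite A} T \<alpha> \<longleftrightarrow> aleph0_rank T \<le> \<alpha>" for \<alpha> :: "'o ordinal"
      unfolding rank_le_iff_rank_of aleph0_rank_def by blast
    then show "rank_le {A. finite A} T \<alpha> \<longleftrightarrow> aleph0_rank T \<le> \<alpha>" .
    show "rank_le I G (aleph0_rank T :: 'o ordinal)"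
      by (rule tree_decomposition_rank_le[OF assms(2,1) D]) (simp add: rk)
  qed
  have equiv: "(\<exists>\<alpha> :: 'o ordinal. has_rank I G \<alpha>) \<longleftrightarrow> traceable TYPE('t) I G"
  proof
    assume "\<exists>\<alpha> :: 'o ordinal. has_rank I G \<alpha>"
    then obtain \<alpha> :: "'o ordinal" where "rank_le I G \<alpha>" unfolding rank_le_def by blast
    then show "traceable TYPE('t) I G" using to_tree unfolding traceable_def by blast
  next
    assume "traceable TYPE('t) I G"
    then show "\<exists>\<alpha> :: 'o ordinal. has_rank I G \<alpha>"
      using from_tree(1) unfolding traceable_def rank_le_def by blast
  qed
  have "(rank_of I G :: 'o ordinal) =
      (LEAST \<rho>. \<rho> \<in> {aleph0_rank T | (T :: 't ugraph) V. rayless_decomposition_into I G T V})"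
    if rk: "\<exists>\<alpha> :: 'o ordinal. has_rank I G \<alpha>"
  proof -
    let ?\<rho> = "rank_of I G :: 'o ordinal"
    have lower: "?\<rho> \<le> aleph0_rank T" if "rayless_decomposition_into I G T V" for T :: "'t ugraph" and V
      using from_tree(1)[OF that] unfolding rank_le_iff_rank_of by blast
    have "rank_le I G ?\<rho>" unfolding rank_le_iff_rank_of using rk by blast
    then obtain T :: "'t ugraph" and V
      where T: "rayless_decomposition_into I G T V" "rank_le {A. finite A} T ?\<rho>"
      using to_tree by blast
    \<comment> \<open>The constructed tree has rank at most \<open>?\<rho>\<close>, and every
      admissible tree has rank at least \<open>?\<rho>\<close>, so the minimum is attained at
      \<open>T\<close>.\<close>
    then have "aleph0_rank T = ?\<rho>" using lower[OF T(1)] from_tree(2)[OF T(1)] by (metis order_antisym)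
    then show ?thesis
    proof (intro Least_equality[symmetric])
      show "?\<rho> \<in> {aleph0_rank T | (T :: 't ugraph) V. rayless_decomposition_into I G T V}"
        using T(1) \<open>aleph0_rank T = ?\<rho>\<close>[symmetric] by blast
    qed (use lower in blast)
  qed
  with equiv show ?thesis by blast
qed

end
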